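(* Let $G=(V,E)$ be any finite undirected graph with $n=|V|$. Then $$\min_F \mathsf{con}_2(F) = \max_{s} \Lambda_s(G),$$ where the minimum is over all unit $K_n$-flows $F$ in $G$ and the maximum is over all non-negative weight functions $s:V\to\mathbb R_+$.
   Context: $K_n$ is the complete graph on $n$ vertices. For $u,v\in V$, $\mathcal P_{uv}$ is the set of all paths in $G$ between $u$ and $v$, and $\mathcal P=\bigcup_{u,v}\mathcal P_{uv}$. A flow is a map $F:\mathcal P\to\mathbb R_+$; its vertex congestion at $v$ is $C_F(v)=\sum_{p\ni v}F(p)$, and $\mathsf{con}_2(F)=\left(\sum_{v\in V}C_F(v)^2\right)^{1/2}$. A unit $K_n$-flow is a flow such that, for every pair of distinct vertices $u,v\in V$, $\sum_{p\in\mathcal P_{uv}}F(p)=1$ (and $F$ vanishes on no other paths than these, trivially). A weight function $s:V\to\mathbb R_+$ induces the semi-metric $d_s(u,v)=\min_{p\in\mathcal P_{uv}}\sum_{x\in p}s(x)$ (the sum includes the endpoints), and $$\Lambda_s(G)=\frac{\sum_{u,v\in V}d_s(u,v)}{\sqrt{\sum_{v\in V}s(v)^2}}$$ (for $s$ not identically zero).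
   Formalization: The sum in Λ_s is taken over unordered pairs of distinct vertices (with ordered pairs or diagonal terms the equality fails, e.g. for K_2 or n=1); paths are undirected and simple; n≥1; for disconnected G, where no unit flow exists, both sides are +∞. *)

theory Defs
  imports "HOL-Analysis.Analysis" "Graph_Theory.Graph_Theory"
begin

text \<open>
  Finite simple undirected graphs are the locale \<^term>\<open>graph\<close> of Graph_Theory: symmetric, loop-free
  finite digraphs without parallel arcs. An undirected path is a simple path up to reversal; it is
  represented by the two-element set consisting of its vertex sequence and the reversed sequence
  (a singleton for the trivial path at a vertex). Hence the paths between \<open>u\<close> and \<open>v\<close> and
  those between \<open>v\<close> and \<open>u\<close> are the same objects.
\<close>

definition paths_between :: "('a, 'b) pre_digraph \<Rightarrow> 'a \<Rightarrow> 'a \<Rightarrow> 'a list set set" where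
  "paths_between G u v =
     {{pre_digraph.awalk_verts G u p, rev (pre_digraph.awalk_verts G u p)} | p.
        pre_digraph.apath G u p v}"

definition all_paths :: "('a, 'b) pre_digraph \<Rightarrow> 'a list set set" where
  "all_paths G = (\<Union>u\<in>verts G. \<Union>v\<in>verts G. paths_between G u v)"

definition path_verts :: "'a list set \<Rightarrow> 'a set" where
  "path_verts P = (\<Union>xs\<in>P. set xs)"

text \<open>
  Only the values of a flow on \<^term>\<open>all_paths G\<close> matter.
\<close>

definition is_flow :: "('a, 'b) pre_digraph \<Rightarrow> ('a list set \<Rightarrow> real) \<Rightarrow> bool" where
  "is_flow G F \<longleftrightarrow> (\<forall>P\<in>all_paths G. 0 \<le> F P)"

definition vertex_congestion ::
    "('a, 'b) pre_digraph \<Rightarrow> ('a list set \<Rightarrow> real) \<Rightarrow> 'a \<Rightarrow> real" where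
  "vertex_congestion G F v = (\<Sum>P | P \<in> all_paths G \<and> v \<in> path_verts P. F P)"

definition con2 :: "('a, 'b) pre_digraph \<Rightarrow> ('a list set \<Rightarrow> real) \<Rightarrow> real" where
  "con2 G F = sqrt (\<Sum>v\<in>verts G. (vertex_congestion G F v)\<^sup>2)"

text \<open>
  The complete graph has no loops, so a unit flow routes nothing along the trivial paths.
\<close>

definition unit_Kn_flows :: "('a, 'b) pre_digraph \<Rightarrow> ('a list set \<Rightarrow> real) set" where
  "unit_Kn_flows G =
     {F. is_flow G F
       \<and> (\<forall>u\<in>verts G. \<forall>v\<in>verts G. u \<noteq> v \<longrightarrow> (\<Sum>P\<in>paths_between G u v. F P) = 1)
       \<and> (\<forall>u\<in>verts G. \<forall>P\<in>paths_between G u u. F P = 0)}"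

definition weight_functions :: "('a, 'b) pre_digraph \<Rightarrow> ('a \<Rightarrow> real) set" where
  "weight_functions G = {s. (\<forall>v\<in>verts G. 0 \<le> s v) \<and> (\<exists>v\<in>verts G. s v \<noteq> 0)}"

text \<open>
  There are finitely many paths, so the infimum is a minimum whenever a path exists; it is
  \<open>\<infinity>\<close> if \<open>u\<close> and \<open>v\<close> lie in different components.
\<close>

definition wdist :: "('a, 'b) pre_digraph \<Rightarrow> ('a \<Rightarrow> real) \<Rightarrow> 'a \<Rightarrow> 'a \<Rightarrow> ereal" where
  "wdist G s u v = (INF P\<in>paths_between G u v. ereal (\<Sum>x\<in>path_verts P. s x))"

text \<open>
  The numerator ranges over the pairs for which a unit \<open>K\<^sub>n\<close>-flow has a demand, i.e. the unordered
  pairs of distinct vertices. Each of them occurs twice in the sum below, and \<^term>\<open>wdist G s\<close> is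
  symmetric (see \<open>wdist_commute\<close>), whence the division by 2.
\<close>

definition Lambda :: "('a, 'b) pre_digraph \<Rightarrow> ('a \<Rightarrow> real) \<Rightarrow> ereal" where
  "Lambda G s =
     ((\<Sum>(u, v) | u \<in> verts G \<and> v \<in> verts G \<and> u \<noteq> v. wdist G s u v) / 2)
       / ereal (sqrt (\<Sum>v\<in>verts G. (s v)\<^sup>2))"

lemma (in graph) awalk_reverse:
  assumes "awalk u p v"
  shows "\<exists>q. awalk v q u \<and> awalk_verts v q = rev (awalk_verts u p)"
  using assms
proof (induction p arbitrary: u)
  case Nil
  then show ?case by (auto simp: awalk_def intro!: exI[of _ "[]"])
next
  case (Cons e p)
  then have e: "e \<in> arcs G" "u = tail G e" and w: "awalk (head G e) p v"
    by (auto simp: awalk_Cons_iff)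
  from Cons.IH[OF w] obtain q where
    q: "awalk v q (head G e)" "awalk_verts v q = rev (awalk_verts (head G e) p)" by blast
  have "(tail G e, head G e) \<in> arcs_ends G" using e by (auto simp: arcs_ends_conv)
  then have "(head G e, tail G e) \<in> arcs_ends G"
    using sym_arcs by (auto simp: symmetric_def dest: symD)
  then obtain f where f: "f \<in> arcs G" "tail G f = head G e" "head G f = tail G e"
    by (auto simp: arcs_ends_conv)
  then have fw: "awalk (head G e) [f] u" using e by (auto simp: awalk_Cons_iff awalk_Nil_iff)
  have "awalk v (q @ [f]) u" using awalk_appendI[OF q(1) fw] .
  moreover have "awalk_verts v (q @ [f]) = rev (awalk_verts u (e # p))"
    using awalk_verts_append[OF \<open>awalk v (q @ [f]) u\<close>] q f e awlast_if_cas
    by (auto simp: awalk_def)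
  ultimately show ?case by blast
qed

lemma (in graph) paths_between_commute: "paths_between G u v = paths_between G v u"
proof -
  have "paths_between G u v \<subseteq> paths_between G v u" for u v
  proof
    fix P assume "P \<in> paths_between G u v"
    then obtain p where p: "apath u p v" "P = {awalk_verts u p, rev (awalk_verts u p)}"
      by (auto simp: paths_between_def)
    then obtain q where "awalk v q u" "awalk_verts v q = rev (awalk_verts u p)"
      using awalk_reverse[of u p v] unfolding apath_def by blast
    with p show "P \<in> paths_between G v u"
      by (auto simp: paths_between_def apath_def intro!: exI[of _ q])
  qed
  then show ?thesis by blast
qed

lemma (in graph) wdist_commute: "wdist G s u v = wdist G s v u"
  by (simp add: wdist_def paths_between_commute)

end

theory Submission
  imports Defs
begin

text \<open>
  For a weight \<open>s\<close> and a unit flow \<open>F\<close> with congestion vector \<open>C\<close>, routing each pair along a path costs at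
  least its distance, so the numerator of \<open>\<Lambda>\<^sub>s\<close> is at most \<open>\<langle>s, C\<rangle> \<le> \<parallel>s\<parallel> \<parallel>C\<parallel>\<close>, with equality in the first
  step for the flow along shortest paths. Conversely, the congestion vectors form a compact convex
  set. If \<open>c\<close> is its point of least norm, then \<open>\<langle>c, C\<rangle> \<ge> \<parallel>c\<parallel>\<^sup>2\<close> for every congestion vector \<open>C\<close>; taking
  the shortest-path flow for the weight \<open>s = c\<close> gives \<open>\<Lambda>\<^sub>c \<ge> \<parallel>c\<parallel>\<close>.
\<close>

definition path_weight :: "('a \<Rightarrow> real) \<Rightarrow> 'a list set \<Rightarrow> real" where
  "path_weight s P = (\<Sum>x\<in>path_verts P. s x)"

definition vertex_pairs :: "('a, 'b) pre_digraph \<Rightarrow> ('a \<times> 'a) set" where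
  "vertex_pairs G = {(u, v). u \<in> verts G \<and> v \<in> verts G \<and> u \<noteq> v}"

text \<open>The choice depends on the pair only through the set \<open>paths_between G u v\<close>.
  That set is symmetric in \<open>u\<close> and \<open>v\<close>, so both orders of a pair select
  the same path.\<close>

definition shortest_path ::
    "('a, 'b) pre_digraph \<Rightarrow> ('a \<Rightarrow> real) \<Rightarrow> 'a \<Rightarrow> 'a \<Rightarrow> 'a list set" where
  "shortest_path G s u v = arg_min_on (path_weight s) (paths_between G u v)"

text \<open>An indicator rather than a count over ordered pairs: a path selected by both
  \<open>(u, v)\<close> and \<open>(v, u)\<close> still carries 1, not 2.\<close>

definition shortest_path_flow ::
    "('a, 'b) pre_digraph \<Rightarrow> ('a \<Rightarrow> real) \<Rightarrow> 'a list set \<Rightarrow> real" where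
  "shortest_path_flow G s P =
     of_bool (\<exists>(u, v)\<in>vertex_pairs G. P = shortest_path G s u v)"

lemma con2_eq_L2_set: "con2 G F = L2_set (vertex_congestion G F) (verts G)"
  by (simp add: con2_def L2_set_def)

context graph
begin

section \<open>Finiteness and ends of undirected paths\<close>

lemma finite_vertex_pairs: "finite (vertex_pairs G)"
  by (rule finite_subset[of _ "verts G \<times> verts G"]) (auto simp: vertex_pairs_def)

lemma finite_paths_between: "finite (paths_between G u v)"
proof -
  have "paths_between G u v =
    (\<lambda>p. {awalk_verts u p, rev (awalk_verts u p)}) ` {p. apath u p v}"
    by (auto simp: paths_between_def)
  then show ?thesis using apaths_finite by simp
qed

lemma finite_all_paths: "finite (all_paths G)"
  by (simp add: all_paths_def finite_paths_between)

lemma paths_between_in_verts: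
  assumes "P \<in> paths_between G u v"
  shows "u \<in> verts G" "v \<in> verts G"
  using assms by (auto simp: paths_between_def apath_def)

lemma paths_between_subset_all_paths: "paths_between G u v \<subseteq> all_paths G"
  using paths_between_in_verts by (force simp: all_paths_def)

lemma path_verts_subset:
  assumes "P \<in> all_paths G"
  shows "path_verts P \<subseteq> verts G"
  using assms by (force simp: all_paths_def paths_between_def path_verts_def apath_def)

text \<open>A set of the form \<open>{xs, rev xs}\<close> determines \<open>xs\<close> up to
  reversal, and reversal exchanges \<open>hd\<close> and \<open>last\<close>.\<close>

lemma paths_between_ends:
  assumes "P \<in> paths_between G u v" "P \<in> paths_between G u' v'"
  shows "u' = u \<and> v' = v \<or> u' = v \<and> v' = u"
proof -
  obtain p q where p: "apath u p v" "P = {awalk_verts u p, rev (awalk_verts u p)}"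
    and q: "apath u' q v'" "P = {awalk_verts u' q, rev (awalk_verts u' q)}"
    using assms by (auto simp: paths_between_def)
  have "awalk_verts u' q = awalk_verts u p \<or> awalk_verts u' q = rev (awalk_verts u p)"
    using p(2) q(2) by auto
  moreover have "hd (awalk_verts u p) = u" "last (awalk_verts u p) = v"
    "hd (awalk_verts u' q) = u'" "last (awalk_verts u' q) = v'"
    using p q by (auto simp: apath_def)
  ultimately show ?thesis
    by (auto simp: hd_rev last_rev)
qed

text \<open>Every path with distinct ends lies between exactly two ordered pairs, whence the factor 2.\<close>

lemma sum_vertex_pairs:
  fixes f :: "'a list set \<Rightarrow> real"
  assumes triv: "\<And>u P. P \<in> paths_between G u u \<Longrightarrow> f P = 0"
  shows "(\<Sum>(u, v)\<in>vertex_pairs G. \<Sum>P\<in>paths_between G u v. f P) = 2 * (\<Sum>P\<in>all_paths G. f P)"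
proof -
  have "(\<Sum>(u, v)\<in>vertex_pairs G. \<Sum>P\<in>paths_between G u v. f P)
      = (\<Sum>x\<in>vertex_pairs G. \<Sum>P\<in>all_paths G.
          if P \<in> paths_between G (fst x) (snd x) then f P else 0)"
    by (intro sum.cong refl)
      (auto simp: sum.If_cases finite_all_paths Int_absorb1
        paths_between_subset_all_paths Int_commute case_prod_beta)
  also have "\<dots> = (\<Sum>P\<in>all_paths G. \<Sum>x\<in>vertex_pairs G.
      if P \<in> paths_between G (fst x) (snd x) then f P else 0)"
    by (rule sum.swap)
  also have "\<dots> = (\<Sum>P\<in>all_paths G. 2 * f P)"
  proof (rule sum.cong[OF refl])
    fix P assume "P \<in> all_paths G"
    then obtain u v where P: "P \<in> paths_between G u v" by (auto simp: all_paths_def)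
    have "(\<Sum>x\<in>vertex_pairs G. if P \<in> paths_between G (fst x) (snd x) then f P else 0)
        = real (card (vertex_pairs G \<inter> {x. P \<in> paths_between G (fst x) (snd x)})) * f P"
      by (simp add: sum.If_cases finite_vertex_pairs)
    also have "\<dots> = 2 * f P"
    proof (cases "u = v")
      \<comment> \<open>A trivial path lies between no two distinct vertices, so the left side
        misses it while the right side counts it twice; \<open>f P = 0\<close> reconciles the
        two.\<close>
      case True
      then show ?thesis using triv P by simp
    next
      case False
      have "vertex_pairs G \<inter> {x. P \<in> paths_between G (fst x) (snd x)} = {(u, v), (v, u)}"
        using False P paths_between_in_verts[OF P] paths_between_commute[of u v]
        by (auto simp: vertex_pairs_def dest: paths_between_ends[OF P])
      then show ?thesis using False by simp
    qed
    finally show "(\<Sum>x\<in>vertex_pairs G. if P \<in> paths_between G (fst x) (snd x) then f P else 0)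
        = 2 * f P" .
  qed
  finally show ?thesis by (simp add: sum_distrib_left)
qed

section \<open>Congestion vectors and unit flows\<close>

lemma vertex_congestion_eq:
  "vertex_congestion G F v = (\<Sum>P\<in>all_paths G. if v \<in> path_verts P then F P else 0)"
  by (simp add: vertex_congestion_def sum.If_cases finite_all_paths Int_def)

text \<open>Double counting of incidences between vertices and paths: pairing weights with
  congestions gives the total cost of the flow.\<close>

lemma sum_vertex_congestion:
  "(\<Sum>v\<in>verts G. s v * vertex_congestion G F v) = (\<Sum>P\<in>all_paths G. F P * path_weight s P)"
proof -
  have "(\<Sum>v\<in>verts G. s v * vertex_congestion G F v)
      = (\<Sum>P\<in>all_paths G. \<Sum>v\<in>verts G. if v \<in> path_verts P then s v * F P else 0)"
    by (subst sum.swap)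
      (auto simp: vertex_congestion_eq sum_distrib_left intro!: sum.cong)
  also have "\<dots> = (\<Sum>P\<in>all_paths G. F P * path_weight s P)"
    by (intro sum.cong refl)
      (simp add: sum.If_cases Int_absorb1 path_verts_subset path_weight_def sum_distrib_left
        mult.commute)
  finally show ?thesis .
qed

lemma unit_flow_nonneg: "F \<in> unit_Kn_flows G \<Longrightarrow> P \<in> all_paths G \<Longrightarrow> 0 \<le> F P"
  by (simp add: unit_Kn_flows_def is_flow_def)

lemma unit_flow_sum:
  "F \<in> unit_Kn_flows G \<Longrightarrow> (u, v) \<in> vertex_pairs G \<Longrightarrow> (\<Sum>P\<in>paths_between G u v. F P) = 1"
  by (simp add: unit_Kn_flows_def vertex_pairs_def)

lemma unit_flow_trivial: "F \<in> unit_Kn_flows G \<Longrightarrow> P \<in> paths_between G u u \<Longrightarrow> F P = 0"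
  using paths_between_in_verts by (auto simp: unit_Kn_flows_def)

lemma unit_flow_paths_nonempty:
  assumes "F \<in> unit_Kn_flows G" "(u, v) \<in> vertex_pairs G"
  shows "paths_between G u v \<noteq> {}"
  using unit_flow_sum[OF assms] by auto

lemma vertex_congestion_nonneg:
  "F \<in> unit_Kn_flows G \<Longrightarrow> 0 \<le> vertex_congestion G F v"
  by (auto simp: vertex_congestion_def intro!: sum_nonneg unit_flow_nonneg)

section \<open>Shortest paths and the value of \<open>Lambda\<close>\<close>

lemma shortest_path_in:
  "paths_between G u v \<noteq> {} \<Longrightarrow> shortest_path G s u v \<in> paths_between G u v"
  by (simp add: shortest_path_def arg_min_if_finite finite_paths_between)

lemma shortest_path_le:
  "P \<in> paths_between G u v \<Longrightarrow> path_weight s (shortest_path G s u v) \<le> path_weight s P"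
  unfolding shortest_path_def by (rule arg_min_least) (auto simp: finite_paths_between)

lemma wdist_eq_shortest_path:
  assumes "paths_between G u v \<noteq> {}"
  shows "wdist G s u v = ereal (path_weight s (shortest_path G s u v))"
  unfolding wdist_def path_weight_def[symmetric]
  by (rule antisym) (auto intro!: INF_lower shortest_path_in assms INF_greatest shortest_path_le)

lemma weight_norm_pos:
  assumes "s \<in> weight_functions G"
  shows "0 < L2_set s (verts G)"
proof -
  have "L2_set s (verts G) \<noteq> 0"
    using assms by (auto simp: L2_set_eq_0_iff weight_functions_def)
  then show ?thesis using L2_set_nonneg[of s "verts G"] by linarith
qed

lemma Lambda_eq:
  assumes "\<And>u v. (u, v) \<in> vertex_pairs G \<Longrightarrow> paths_between G u v \<noteq> {}"
    and "s \<in> weight_functions G"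
  shows "Lambda G s = ereal ((\<Sum>(u, v)\<in>vertex_pairs G. path_weight s (shortest_path G s u v)) / 2
    / L2_set s (verts G))"
proof -
  have "(\<Sum>(u, v)\<in>vertex_pairs G. wdist G s u v)
      = (\<Sum>x\<in>vertex_pairs G. ereal (path_weight s (shortest_path G s (fst x) (snd x))))"
    using assms(1) wdist_eq_shortest_path by (intro sum.cong) auto
  then have "(\<Sum>(u, v)\<in>vertex_pairs G. wdist G s u v)
      = ereal (\<Sum>(u, v)\<in>vertex_pairs G. path_weight s (shortest_path G s u v))"
    by (simp add: case_prod_beta)
  then show ?thesis
    using weight_norm_pos[OF assms(2)]
    unfolding Lambda_def vertex_pairs_def[symmetric] L2_set_def[symmetric]
    by (simp add: numeral_eq_ereal)
qed

text \<open>The infimum over no paths is \<infinity>, and the remaining distances, being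
  nonnegative, cannot cancel it.\<close>

lemma Lambda_disconnected:
  assumes "(u, v) \<in> vertex_pairs G" "paths_between G u v = {}" "s \<in> weight_functions G"
  shows "Lambda G s = \<infinity>"
proof -
  have "0 \<le> wdist G s a b" for a b
    unfolding wdist_def
  proof (rule INF_greatest)
    fix P assume "P \<in> paths_between G a b"
    then have "path_verts P \<subseteq> verts G"
      using path_verts_subset paths_between_subset_all_paths by blast
    then show "0 \<le> ereal (\<Sum>x\<in>path_verts P. s x)"
      using assms(3) by (auto simp: weight_functions_def intro!: sum_nonneg)
  qed
  then have "wdist G s u v \<le> (\<Sum>(a, b)\<in>vertex_pairs G. wdist G s a b)"
    using sum_mono2[OF finite_vertex_pairs, of "{(u, v)}" "\<lambda>(a, b). wdist G s a b"] assms(1)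
    by auto
  moreover have "wdist G s u v = \<infinity>" by (simp add: wdist_def assms(2) top_ereal_def)
  ultimately have "(\<Sum>(a, b)\<in>vertex_pairs G. wdist G s a b) = \<infinity>" by simp
  then show ?thesis
    using weight_norm_pos[OF assms(3)]
    unfolding Lambda_def vertex_pairs_def[symmetric] L2_set_def[symmetric]
    by (simp add: numeral_eq_ereal)
qed

section \<open>Every unit flow bounds every \<open>Lambda G s\<close>\<close>

text \<open>The unit demand of a pair is split among its paths, none lighter than the shortest one.
  The factor 2 comes from summing over ordered pairs.\<close>

lemma sum_shortest_path_le:
  assumes F: "F \<in> unit_Kn_flows G"
  shows "(\<Sum>(u, v)\<in>vertex_pairs G. path_weight s (shortest_path G s u v))
    \<le> 2 * (\<Sum>v\<in>verts G. s v * vertex_congestion G F v)"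
proof -
  have "(\<Sum>(u, v)\<in>vertex_pairs G. path_weight s (shortest_path G s u v))
      \<le> (\<Sum>(u, v)\<in>vertex_pairs G. \<Sum>P\<in>paths_between G u v. F P * path_weight s P)"
  proof (rule sum_mono, clarify)
    fix u v assume uv: "(u, v) \<in> vertex_pairs G"
    have "path_weight s (shortest_path G s u v)
        = (\<Sum>P\<in>paths_between G u v. F P * path_weight s (shortest_path G s u v))"
      using unit_flow_sum[OF F uv] by (simp flip: sum_distrib_right)
    also have "\<dots> \<le> (\<Sum>P\<in>paths_between G u v. F P * path_weight s P)"
      using paths_between_subset_all_paths
      by (intro sum_mono mult_left_mono shortest_path_le unit_flow_nonneg[OF F]) auto
    finally show "path_weight s (shortest_path G s u v)
        \<le> (\<Sum>P\<in>paths_between G u v. F P * path_weight s P)" .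
  qed
  also have "\<dots> = 2 * (\<Sum>P\<in>all_paths G. F P * path_weight s P)"
    by (rule sum_vertex_pairs) (simp add: unit_flow_trivial[OF F])
  finally show ?thesis by (simp add: sum_vertex_congestion)
qed

text \<open>The cost bound of \<open>sum_shortest_path_le\<close> followed by
  Cauchy-Schwarz.\<close>

lemma weak_duality:
  assumes F: "F \<in> unit_Kn_flows G" and s: "s \<in> weight_functions G"
  shows "Lambda G s \<le> ereal (con2 G F)"
proof -
  have "(\<Sum>v\<in>verts G. s v * vertex_congestion G F v)
      \<le> (\<Sum>v\<in>verts G. \<bar>s v\<bar> * \<bar>vertex_congestion G F v\<bar>)"
    by (intro sum_mono) (simp flip: abs_mult)
  also have "\<dots> \<le> L2_set s (verts G) * con2 G F"
    unfolding con2_eq_L2_set by (rule L2_set_mult_ineq)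
  finally have "(\<Sum>(u, v)\<in>vertex_pairs G. path_weight s (shortest_path G s u v)) / 2
      \<le> con2 G F * L2_set s (verts G)"
    using sum_shortest_path_le[OF F, of s] by (simp add: mult.commute)
  then show ?thesis
    using weight_norm_pos[OF s] unit_flow_paths_nonempty[OF F]
    by (subst Lambda_eq[OF _ s]) (auto simp: pos_divide_le_eq)
qed

section \<open>Routing along shortest paths\<close>

text \<open>This is the equality case of \<open>sum_shortest_path_le\<close>, since all flow runs on
  paths of least weight.\<close>

lemma shortest_path_flow_unit:
  assumes ne: "\<And>u v. (u, v) \<in> vertex_pairs G \<Longrightarrow> paths_between G u v \<noteq> {}"
  shows "shortest_path_flow G s \<in> unit_Kn_flows G"
    and "2 * (\<Sum>v\<in>verts G. s v * vertex_congestion G (shortest_path_flow G s) v)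
      = (\<Sum>(u, v)\<in>vertex_pairs G. path_weight s (shortest_path G s u v))"
proof -
  let ?F = "shortest_path_flow G s"
  have F: "?F P = of_bool (P = shortest_path G s u v)"
    if uv: "(u, v) \<in> vertex_pairs G" and P: "P \<in> paths_between G u v" for u v P
  proof -
    \<comment> \<open>A pair \<open>(a, b)\<close> that selects \<open>P\<close> has the ends of
      \<open>P\<close>, so it is \<open>(u, v)\<close> or \<open>(v, u)\<close>; both have the same
      selected path.\<close>
    have "P = shortest_path G s u v"
      if "(a, b) \<in> vertex_pairs G" "P = shortest_path G s a b" for a b
    proof -
      have "P \<in> paths_between G a b" using that shortest_path_in[OF ne] by simp
      from paths_between_ends[OF this P] have "paths_between G a b = paths_between G u v"
        using paths_between_commute[of a b] by auto
      then show ?thesis using that(2) by (simp add: shortest_path_def)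
    qed
    then have "(\<exists>(a, b)\<in>vertex_pairs G. P = shortest_path G s a b) \<longleftrightarrow> P = shortest_path G s u v"
      using uv by blast
    then show ?thesis by (simp only: shortest_path_flow_def)
  qed
  have triv: "?F P = 0" if "P \<in> paths_between G u u" for u P
  proof -
    have "\<not> (\<exists>(a, b)\<in>vertex_pairs G. P = shortest_path G s a b)"
    proof clarify
      fix a b assume ab: "(a, b) \<in> vertex_pairs G" "P = shortest_path G s a b"
      then have "P \<in> paths_between G a b" using shortest_path_in[OF ne] by simp
      from paths_between_ends[OF that this] show False using ab by (auto simp: vertex_pairs_def)
    qed
    then show ?thesis by (simp add: shortest_path_flow_def)
  qed
  \<comment> \<open>Used twice: \<open>f\<close> constantly 1 gives the unit demand,
    \<open>f = path_weight s\<close> gives the cost.\<close>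
  have sum: "(\<Sum>P\<in>paths_between G u v. ?F P * f P) = f (shortest_path G s u v)"
    if "(u, v) \<in> vertex_pairs G" for u v and f :: "'a list set \<Rightarrow> real"
  proof -
    have "(\<Sum>P\<in>paths_between G u v. ?F P * f P)
        = (\<Sum>P\<in>paths_between G u v. if P = shortest_path G s u v then f P else 0)"
      using F[OF that] by (intro sum.cong) auto
    then show ?thesis
      using shortest_path_in[OF ne[OF that]] by (simp add: finite_paths_between)
  qed
  show "?F \<in> unit_Kn_flows G"
    using triv sum[of _ _ "\<lambda>_. 1"]
    by (auto simp: unit_Kn_flows_def is_flow_def vertex_pairs_def shortest_path_flow_def)
  have "2 * (\<Sum>P\<in>all_paths G. ?F P * path_weight s P)
      = (\<Sum>(u, v)\<in>vertex_pairs G. \<Sum>P\<in>paths_between G u v. ?F P * path_weight s P)"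
    by (rule sum_vertex_pairs[symmetric]) (simp add: triv)
  also have "\<dots> = (\<Sum>(u, v)\<in>vertex_pairs G. path_weight s (shortest_path G s u v))"
    using sum by (intro sum.cong) auto
  finally show "2 * (\<Sum>v\<in>verts G. s v * vertex_congestion G ?F v)
      = (\<Sum>(u, v)\<in>vertex_pairs G. path_weight s (shortest_path G s u v))"
    by (simp add: sum_vertex_congestion)
qed

section \<open>Existence of a unit flow of least congestion\<close>

lemma vertex_congestion_cong:
  "(\<And>P. P \<in> all_paths G \<Longrightarrow> F P = F' P) \<Longrightarrow> vertex_congestion G F = vertex_congestion G F'"
  by (auto simp: vertex_congestion_def intro!: sum.cong ext)

lemma continuous_on_con2: "continuous_on A (con2 G)"
  unfolding con2_def vertex_congestion_def
  by (intro continuous_intros continuous_on_product_then_coordinatewise continuous_on_id)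

text \<open>Values off \<open>all_paths G\<close> are unconstrained, so the set of unit flows is not
  compact. Setting them to 0 leaves \<open>con2\<close> unchanged and gives a compact set, on which
  the continuous \<open>con2\<close> attains its minimum.\<close>

lemma minimal_unit_flow_exists:
  assumes "unit_Kn_flows G \<noteq> {}"
  obtains F where "F \<in> unit_Kn_flows G" "\<And>F'. F' \<in> unit_Kn_flows G \<Longrightarrow> con2 G F \<le> con2 G F'"
proof -
  define box :: "('a list set \<Rightarrow> real) set" where
    "box = (\<Pi>\<^sub>E P\<in>UNIV. if P \<in> all_paths G then {0..1} else {0})"
  define U where "U = box
    \<inter> (\<Inter>x\<in>vertex_pairs G. {F. (\<Sum>P\<in>paths_between G (fst x) (snd x). F P) = 1})
    \<inter> (\<Inter>u. \<Inter>P\<in>paths_between G u u. {F. F P = 0})"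
  \<comment> \<open>Tychonoff: every factor is a closed interval or a single point.\<close>
  have "compactin (product_topology (\<lambda>_. euclidean) UNIV) box"
    unfolding box_def by (subst compactin_PiE) auto
  then have "compact box" by (simp add: euclidean_product_topology)
  moreover have "closed {F :: 'a list set \<Rightarrow> real. (\<Sum>P\<in>A. F P) = 1}" for A
    by (intro closed_Collect_eq continuous_intros continuous_on_product_then_coordinatewise
        continuous_on_id)
  moreover have "closed {F :: 'a list set \<Rightarrow> real. F P = 0}" for P
    by (intro closed_Collect_eq continuous_intros continuous_on_product_then_coordinatewise
        continuous_on_id)
  ultimately have "compact U"
    unfolding U_def by (intro compact_Int_closed closed_INT) auto
  have sub: "U \<subseteq> unit_Kn_flows G"
  proof
    fix F assume F: "F \<in> U"
    have "0 \<le> F P" if "P \<in> all_paths G" for P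
    proof -
      have "F P \<in> (if P \<in> all_paths G then {0..1} else {0})"
        using F unfolding U_def box_def by blast
      then show ?thesis using that by simp
    qed
    then show "F \<in> unit_Kn_flows G"
      using F by (auto simp: U_def vertex_pairs_def unit_Kn_flows_def is_flow_def)
  qed
  have restrict: "\<exists>F'\<in>U. con2 G F' = con2 G F" if F: "F \<in> unit_Kn_flows G" for F
  proof
    define F' where "F' = (\<lambda>P. if P \<in> all_paths G then F P else 0)"
    have eq: "F' P = F P" if "P \<in> paths_between G u v" for u v P
      using that paths_between_subset_all_paths by (auto simp: F'_def)
    show "con2 G F' = con2 G F"
      using vertex_congestion_cong[of F' F] by (simp add: con2_def F'_def)
    \<comment> \<open>The value \<open>F P\<close> is one of the nonnegative summands of a unit
      demand, or 0 on a trivial path.\<close>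
    have "F P \<le> 1" if P: "P \<in> all_paths G" for P
    proof -
      obtain u v where uv: "P \<in> paths_between G u v" using P by (auto simp: all_paths_def)
      show ?thesis
      proof (cases "u = v")
        case True
        then show ?thesis using unit_flow_trivial[OF F] uv by simp
      next
        case False
        then have "(u, v) \<in> vertex_pairs G"
          using paths_between_in_verts[OF uv] by (simp add: vertex_pairs_def)
        from unit_flow_sum[OF F this] show ?thesis
          using member_le_sum[OF uv, of F] finite_paths_between
            unit_flow_nonneg[OF F] paths_between_subset_all_paths by (metis DiffE subsetD)
      qed
    qed
    then have "F' \<in> box"
      using unit_flow_nonneg[OF F] by (auto simp: box_def F'_def)
    then show "F' \<in> U"
      using unit_flow_sum[OF F] unit_flow_trivial[OF F] by (auto simp: U_def eq)
  qed
  then have "U \<noteq> {}" using assms by auto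
  with continuous_attains_inf[OF \<open>compact U\<close> _ continuous_on_con2]
  obtain F where "F \<in> U" "\<forall>F'\<in>U. con2 G F \<le> con2 G F'" by blast
  then show ?thesis using that sub restrict by (metis subsetD)
qed

section \<open>Convexity and first-order optimality\<close>

lemma unit_flow_convex:
  assumes "F \<in> unit_Kn_flows G" "F' \<in> unit_Kn_flows G" "0 \<le> t" "t \<le> 1"
  shows "(\<lambda>P. (1 - t) * F P + t * F' P) \<in> unit_Kn_flows G"
  using assms by (auto simp: unit_Kn_flows_def is_flow_def sum.distrib simp flip: sum_distrib_left)

lemma vertex_congestion_combination:
  "vertex_congestion G (\<lambda>P. a * F P + b * F' P) v
    = a * vertex_congestion G F v + b * vertex_congestion G F' v"
  by (simp add: vertex_congestion_def sum.distrib sum_distrib_left)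

text \<open>The variational inequality for the point of least norm in the convex set of congestions.\<close>

lemma minimal_unit_flow_inner_le:
  assumes F: "F \<in> unit_Kn_flows G" and min: "\<And>F'. F' \<in> unit_Kn_flows G \<Longrightarrow> con2 G F \<le> con2 G F'"
    and F': "F' \<in> unit_Kn_flows G"
  shows "(\<Sum>v\<in>verts G. (vertex_congestion G F v)\<^sup>2)
    \<le> (\<Sum>v\<in>verts G. vertex_congestion G F v * vertex_congestion G F' v)"
proof -
  define c where "c = vertex_congestion G F"
  define d where "d = (\<lambda>v. vertex_congestion G F' v - c v)"
  define A where "A = (\<Sum>v\<in>verts G. c v * d v)"
  define B where "B = (\<Sum>v\<in>verts G. (d v)\<^sup>2)"
  \<comment> \<open>Moving from \<open>F\<close> towards \<open>F'\<close> by \<open>t\<close>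
    changes the squared norm by \<open>t * (2 * A + t * B)\<close>, which minimality makes
    nonnegative; then \<open>t\<close> is divided out.\<close>
  have step: "0 \<le> 2 * A + t * B" if t: "0 < t" "t \<le> 1" for t
  proof -
    let ?H = "\<lambda>P. (1 - t) * F P + t * F' P"
    have "?H \<in> unit_Kn_flows G" using unit_flow_convex[OF F F'] t by simp
    then have "(\<Sum>v\<in>verts G. (c v)\<^sup>2) \<le> (\<Sum>v\<in>verts G. (vertex_congestion G ?H v)\<^sup>2)"
      using min by (simp add: con2_def c_def)
    also have "\<dots> = (\<Sum>v\<in>verts G. (c v)\<^sup>2 + (2 * t * (c v * d v) + t\<^sup>2 * (d v)\<^sup>2))"
      by (intro sum.cong refl, unfold vertex_congestion_combination)
        (simp add: c_def d_def power2_eq_square algebra_simps)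
    also have "\<dots> = (\<Sum>v\<in>verts G. (c v)\<^sup>2) + t * (2 * A + t * B)"
      by (simp add: A_def B_def sum.distrib sum_distrib_left power2_eq_square algebra_simps)
    finally have "0 \<le> t * (2 * A + t * B)" by simp
    then show ?thesis using t by (simp add: zero_le_mult_iff)
  qed
  \<comment> \<open>Letting \<open>t\<close> tend to 0 from the right leaves
    \<open>0 \<le> A\<close>, which is the claim once \<open>d\<close> is expanded.\<close>
  have "((\<lambda>t. 2 * A + t * B) \<longlongrightarrow> 2 * A + 0 * B) (at_right 0)"
    by (intro tendsto_intros)
  moreover have "eventually (\<lambda>t. 0 \<le> 2 * A + t * B) (at_right 0)"
    using step by (auto simp: eventually_at_right_field intro!: exI[of _ 1])
  ultimately have "0 \<le> 2 * A + 0 * B"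
    by (intro tendsto_lowerbound) auto
  then show ?thesis
    by (simp add: A_def c_def d_def power2_eq_square sum_subtractf algebra_simps)
qed

section \<open>Strong duality\<close>

lemma strong_duality:
  assumes ne: "\<And>u v. (u, v) \<in> vertex_pairs G \<Longrightarrow> paths_between G u v \<noteq> {}"
    and "verts G \<noteq> {}"
  obtains F s where "F \<in> unit_Kn_flows G" "s \<in> weight_functions G"
    "ereal (con2 G F) \<le> Lambda G s"
proof -
  have "unit_Kn_flows G \<noteq> {}" using shortest_path_flow_unit(1)[OF ne] by auto
  then obtain F where F: "F \<in> unit_Kn_flows G"
    and min: "\<And>F'. F' \<in> unit_Kn_flows G \<Longrightarrow> con2 G F \<le> con2 G F'"
    using minimal_unit_flow_exists by blast
  define s where "s = vertex_congestion G F"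
  show ?thesis
  proof (cases "con2 G F = 0")
    \<comment> \<open>Here the congestion vanishes, as for a single vertex, and is not an admissible
      weight. Any weight serves, because \<open>Lambda\<close> is nonnegative.\<close>
    case True
    have one: "(\<lambda>_. 1) \<in> weight_functions G"
      using \<open>verts G \<noteq> {}\<close> by (auto simp: weight_functions_def)
    have "0 \<le> Lambda G (\<lambda>_. 1)"
      by (subst Lambda_eq[OF ne one]) (auto simp: path_weight_def intro!: divide_nonneg_nonneg sum_nonneg)
    then show ?thesis using that[OF F one] True by (simp add: zero_ereal_def)
  next
    case False
    have norm: "con2 G F = L2_set s (verts G)" by (simp add: s_def con2_eq_L2_set)
    have s: "s \<in> weight_functions G"
      using False vertex_congestion_nonneg[OF F]
      by (auto simp: weight_functions_def norm L2_set_eq_0_iff) (simp add: s_def)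
    \<comment> \<open>Testing the optimality of \<open>F\<close> against this flow works because its
      cost under \<open>s\<close> is exactly the numerator of \<open>Lambda G s\<close>.\<close>
    let ?F' = "shortest_path_flow G s"
    have "(\<Sum>v\<in>verts G. (s v)\<^sup>2) \<le> (\<Sum>v\<in>verts G. s v * vertex_congestion G ?F' v)"
      unfolding s_def
      by (rule minimal_unit_flow_inner_le[OF F min shortest_path_flow_unit(1)[OF ne]])
    also have "\<dots> = (\<Sum>(u, v)\<in>vertex_pairs G. path_weight s (shortest_path G s u v)) / 2"
      using shortest_path_flow_unit(2)[OF ne, of s] by simp
    finally have "L2_set s (verts G) * L2_set s (verts G)
        \<le> (\<Sum>(u, v)\<in>vertex_pairs G. path_weight s (shortest_path G s u v)) / 2"
      by (simp add: L2_set_def sum_nonneg)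
    then have "ereal (con2 G F) \<le> Lambda G s"
      using weight_norm_pos[OF s]
      by (subst Lambda_eq[OF ne s]) (auto simp: norm pos_le_divide_eq)
    then show ?thesis using that[OF F s] by blast
  qed
qed

text \<open>Symmetry of the arcs turns connectedness into directed reachability, and a walk can be
  shortened to a simple path.\<close>

lemma connected_paths_nonempty:
  assumes "Digraph_Component.connected G" "u \<in> verts G" "v \<in> verts G"
  shows "paths_between G u v \<noteq> {}"
proof -
  have "strongly_connected G"
    using symmetric_connected_imp_strongly_connected[OF sym_arcs assms(1)] .
  then obtain p where "apath u p v" using assms reachable_apath by blast
  then show ?thesis by (auto simp: paths_between_def)
qed

end

text \<open>In a disconnected graph no unit flow exists and both sides are \<infinity>. Attainment
  of the minimum is therefore asserted for connected graphs, while the maximum is attained in either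
  case.\<close>

theorem theorem2p2:
  fixes G :: "('a, 'b) pre_digraph"
  assumes "graph G" and "verts G \<noteq> {}"
  shows "(INF F\<in>unit_Kn_flows G. ereal (con2 G F)) = (SUP s\<in>weight_functions G. Lambda G s)
    \<and> (Digraph_Component.connected G \<longrightarrow>
        (\<exists>F\<in>unit_Kn_flows G. ereal (con2 G F) = (INF F\<in>unit_Kn_flows G. ereal (con2 G F))))
    \<and> (\<exists>s\<in>weight_functions G. Lambda G s = (SUP s\<in>weight_functions G. Lambda G s))"
proof -
  interpret graph G by fact
  let ?I = "INF F\<in>unit_Kn_flows G. ereal (con2 G F)"
  let ?S = "SUP s\<in>weight_functions G. Lambda G s"
  have le: "?S \<le> ?I"
    by (intro SUP_least INF_greatest weak_duality)
  show ?thesis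
  proof (cases "\<forall>(u, v)\<in>vertex_pairs G. paths_between G u v \<noteq> {}")
    case True
    then have ne: "paths_between G u v \<noteq> {}" if "(u, v) \<in> vertex_pairs G" for u v
      using that by auto
    obtain F s where F: "F \<in> unit_Kn_flows G" and s: "s \<in> weight_functions G"
      and "ereal (con2 G F) \<le> Lambda G s"
      using strong_duality[OF ne assms(2)] by blast
    moreover have "?I \<le> ereal (con2 G F)" using F by (rule INF_lower)
    moreover have "Lambda G s \<le> ?S" using s by (rule SUP_upper)
    \<comment> \<open>The chain \<open>?I \<le> con2 G F \<le> Lambda G s \<le> ?S \<le> ?I\<close>
      collapses to equalities.\<close>
    ultimately have "?I = ?S" "ereal (con2 G F) = ?I" "Lambda G s = ?S" using le by auto
    then show ?thesis using F s by blast
  next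
    case False
    then obtain u v where uv: "(u, v) \<in> vertex_pairs G" "paths_between G u v = {}" by auto
    then have "\<not> Digraph_Component.connected G"
      using connected_paths_nonempty by (auto simp: vertex_pairs_def)
    moreover have one: "(\<lambda>_. 1) \<in> weight_functions G"
      using assms(2) by (auto simp: weight_functions_def)
    moreover have "Lambda G (\<lambda>_. 1) = \<infinity>" using Lambda_disconnected[OF uv one] .
    moreover from this have "?S = \<infinity>" using SUP_upper[OF one, of "Lambda G"] by simp
    \<comment> \<open>With \<open>?S\<close> infinite, weak duality forces \<open>?I\<close> to be
      infinite too, and the constant weight attains the supremum.\<close>
    ultimately show ?thesis using le by auto
  qed
qed

end
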